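(* Let $k\ge 2$, let $F=F(a_1,\dots,a_k)$, let $m\ge 2$, and let $q=(q_v)_{|v|=m}\in Q_m$ be a point all of whose coordinates are rational. Then $q\in\alpha_m(C)$ (that is, there is a nontrivial cyclic word $w$ in $F$ with $f_w(v)=q_v$ for all $v\in F$ with $|v|=m$) if and only if the underlying topological (undirected) graph of the improved initial graph $\Gamma_q'$ is connected.
   Context: Let $X=\{a_1,\dots,a_k\}^{\pm1}$; elements of $F$ are identified with freely reduced words over $X$, and $|v|$ is the word length. A cyclic word is an equivalence class of cyclically reduced words up to cyclic permutation; $C$ is the set of nontrivial cyclic words; $\|w\|$ is the length of a cyclic word $w$. For a nontrivial cyclic word $w$ represented by the cyclically reduced word $x_1\dots x_N$ ($x_i\in X$), extend $x_i$ to all $i\in\mathbb Z$ by $x_{i+N}=x_i$; for a freely reduced word $u$ of length $m\geq 1$, $n_w(u)$ is the number of $i\in\{1,\dots,N\}$ with $x_ix_{i+1}\cdots x_{i+m-1}=u$ (here $m>N$ is allowed), and $f_w(u)=n_w(u)/\|w\|$. Let $D(m)=2k(2k-1)^{m-1}$ be the number of elements of length $m$ in $F$; coordinates in $\mathbb R^{D(m)}$ are indexed by $v\in F$, $|v|=m$. $Q_m\subseteq\mathbb R^{D(m)}$ is the set of $q=(q_v)_{|v|=m}$ such that: (1) $\sum_{|v|=m}q_v=1$; (2) $q_v\ge0$ for all $v$; (3) for each $u\in F$ with $|u|=m-1$, $\sum_{x\in X,|ux|=m}q_{ux}=\sum_{y\in X,|yu|=m}q_{yu}$. The map $\alpha_m:C\to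 Q_m$ is $\alpha_m(w)=(f_w(v))_{|v|=m}$. For $q\in Q_m$ the initial graph $\Gamma_q$ is the labelled directed graph with vertex set $\{u\in F:|u|=m-1\}$ and, for each $v\in F$ with $|v|=m$, one directed edge labelled $q_v$ from $v_-$ to $v_+$, where $v_-$ and $v_+$ are the initial and terminal segments of $v$ of length $m-1$. The improved initial graph $\Gamma_q'$ is obtained from $\Gamma_q$ by removing all edges labelled $0$ and then removing all isolated vertices. *)

theory Defs
  imports Complex_Main "HOL-Library.FuncSet" "Graph_Theory.Digraph_Component"
begin

section \<open>Freely reduced words\<close>

text \<open>The letter \<open>(i, False)\<close> is the \<open>i\<close>-th free generator (generators are numbered
  from \<open>0\<close>) and \<open>(i, True)\<close> is its inverse.\<close>

type_synonym letter = "nat \<times> bool"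
type_synonym fword = "letter list"

definition inv_letter :: "letter \<Rightarrow> letter" where
  "inv_letter x = (fst x, \<not> snd x)"

definition letters :: "nat \<Rightarrow> letter set" where
  "letters k = {..<k} \<times> UNIV"

definition reduced :: "fword \<Rightarrow> bool" where
  "reduced w \<longleftrightarrow> successively (\<lambda>x y. y \<noteq> inv_letter x) w"

definition free_words :: "nat \<Rightarrow> fword set" where
  "free_words k = {w. set w \<subseteq> letters k \<and> reduced w}"

definition free_words_of_length :: "nat \<Rightarrow> nat \<Rightarrow> fword set" where
  "free_words_of_length k m = {v \<in> free_words k. length v = m}"


section \<open>Cyclic words\<close>

definition cyclically_reduced :: "fword \<Rightarrow> bool" where
  "cyclically_reduced w \<longleftrightarrow> reduced w \<and> (w \<noteq> [] \<longrightarrow> hd w \<noteq> inv_letter (last w))"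

definition cyc_reduced_words :: "nat \<Rightarrow> fword set" where
  "cyc_reduced_words k = {w \<in> free_words k. cyclically_reduced w}"

definition cyc_rel :: "nat \<Rightarrow> (fword \<times> fword) set" where
  "cyc_rel k = {(u, v) \<in> cyc_reduced_words k \<times> cyc_reduced_words k. \<exists>n. v = rotate n u}"

text \<open>The nontrivial cyclic words: all classes except that of the empty word.\<close>

definition cyclic_words :: "nat \<Rightarrow> fword set set" where
  "cyclic_words k = cyc_reduced_words k // cyc_rel k - {{[]}}"

text \<open>Occurrences of \<open>u\<close> in the periodic extension of the nonempty word \<open>w\<close>, counted by
  their starting position in one period; \<open>u\<close> may be longer than \<open>w\<close>.\<close>

definition word_occ :: "fword \<Rightarrow> fword \<Rightarrow> nat" where
  "word_occ w u =
     card {i. i < length w \<and> (\<forall>j < length u. w ! ((i + j) mod length w) = u ! j)}"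

text \<open>On a cyclic word the following are computed from any representative; that the choice
  is immaterial is shown below.\<close>

definition cyc_length :: "fword set \<Rightarrow> nat" where
  "cyc_length W = the_elem (length ` W)"

definition cyc_occ :: "fword set \<Rightarrow> fword \<Rightarrow> nat" where
  "cyc_occ W u = the_elem ((\<lambda>w. word_occ w u) ` W)"

definition cyc_freq :: "fword set \<Rightarrow> fword \<Rightarrow> real" where
  "cyc_freq W u = real (cyc_occ W u) / real (cyc_length W)"

lemma word_occ_rotate1: "word_occ (rotate1 w) u = word_occ w u"
proof (cases "w = []")
  case True
  then show ?thesis by simp
next
  case False
  let ?N = "length w"
  let ?A = "{i. i < ?N \<and> (\<forall>j < length u. rotate1 w ! ((i + j) mod ?N) = u ! j)}"
  let ?B = "{i. i < ?N \<and> (\<forall>j < length u. w ! ((i + j) mod ?N) = u ! j)}"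
  have N: "?N > 0" using False by simp
  have shift: "rotate1 w ! ((i + j) mod ?N) = w ! ((Suc i mod ?N + j) mod ?N)" for i j
  proof -
    have "rotate1 w ! ((i + j) mod ?N) = w ! (Suc ((i + j) mod ?N) mod ?N)"
      using N by (simp add: nth_rotate1)
    also have "Suc ((i + j) mod ?N) mod ?N = (Suc i mod ?N + j) mod ?N"
      by (metis add_Suc mod_Suc_eq mod_add_left_eq)
    finally show ?thesis .
  qed
  have inj: "inj_on (\<lambda>i. Suc i mod ?N) {..<?N}"
    by (auto simp: inj_on_def mod_Suc split: if_splits)
  have "(\<lambda>i. Suc i mod ?N) ` {..<?N} = {..<?N}"
    by (rule endo_inj_surj) (use N inj in auto)
  then have "bij_betw (\<lambda>i. Suc i mod ?N) {..<?N} {..<?N}"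
    using inj by (simp add: bij_betw_def)
  moreover have "(\<forall>j < length u. rotate1 w ! ((i + j) mod ?N) = u ! j) \<longleftrightarrow>
      (\<forall>j < length u. w ! ((Suc i mod ?N + j) mod ?N) = u ! j)" for i
    by (simp only: shift)
  ultimately have "bij_betw (\<lambda>i. Suc i mod ?N)
      {i \<in> {..<?N}. \<forall>j < length u. rotate1 w ! ((i + j) mod ?N) = u ! j}
      {i \<in> {..<?N}. \<forall>j < length u. w ! ((i + j) mod ?N) = u ! j}"
    by (intro bij_betw_Collect) auto
  then have "bij_betw (\<lambda>i. Suc i mod ?N) ?A ?B" by simp
  then show ?thesis
    unfolding word_occ_def by (simp add: bij_betw_same_card)
qed

lemma word_occ_rotate: "word_occ (rotate n w) u = word_occ w u"
  by (induction n) (simp_all add: word_occ_rotate1)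

lemma equiv_cyc_rel: "equiv (cyc_reduced_words k) (cyc_rel k)"
proof (rule equivI)
  show "cyc_rel k \<subseteq> cyc_reduced_words k \<times> cyc_reduced_words k"
    by (auto simp: cyc_rel_def)
  show "refl_on (cyc_reduced_words k) (cyc_rel k)"
    by (auto simp: refl_on_def cyc_rel_def intro: exI[of _ 0])
  show "sym (cyc_rel k)"
  proof (rule symI)
    fix u v assume uv: "(u, v) \<in> cyc_rel k"
    then obtain n where n: "v = rotate n u" by (auto simp: cyc_rel_def)
    have "u = rotate (length u - n mod length u) v"
    proof (cases "u = []")
      case False
      then have le: "n mod length u \<le> length u" by simp
      have "(length u - n mod length u + n) mod length u =
          (length u - n mod length u + n mod length u) mod length u"
        by (rule mod_add_right_eq[symmetric])
      also have "\<dots> = 0" using le by simp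
      finally have "(length u - n mod length u + n) mod length u = 0" .
      then have "rotate (length u - n mod length u + n) u = rotate 0 u"
        by (metis mod_0 rotate_conv_mod)
      then show ?thesis by (simp add: n rotate_rotate)
    qed (simp add: n)
    then show "(v, u) \<in> cyc_rel k" using uv unfolding cyc_rel_def by blast
  qed
  show "trans (cyc_rel k)"
    by (rule transI) (auto simp: cyc_rel_def rotate_rotate)
qed

lemma cyc_occ_class:
  assumes "w \<in> cyc_reduced_words k"
  shows "cyc_occ (cyc_rel k `` {w}) u = word_occ w u"
proof -
  have "w \<in> cyc_rel k `` {w}"
    using equiv_class_self[OF equiv_cyc_rel assms] .
  moreover have "word_occ v u = word_occ w u" if "v \<in> cyc_rel k `` {w}" for v
    using that by (auto simp: cyc_rel_def word_occ_rotate)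
  ultimately have "(\<lambda>w. word_occ w u) ` (cyc_rel k `` {w}) = {word_occ w u}"
    by blast
  then show ?thesis by (simp add: cyc_occ_def)
qed

lemma cyc_length_class:
  assumes "w \<in> cyc_reduced_words k"
  shows "cyc_length (cyc_rel k `` {w}) = length w"
proof -
  have "w \<in> cyc_rel k `` {w}"
    using equiv_class_self[OF equiv_cyc_rel assms] .
  moreover have "length v = length w" if "v \<in> cyc_rel k `` {w}" for v
    using that by (auto simp: cyc_rel_def)
  ultimately have "length ` (cyc_rel k `` {w}) = {length w}"
    by blast
  then show ?thesis by (simp add: cyc_length_def)
qed


section \<open>The polyhedron \<open>Q\<close> and the frequency map\<close>

text \<open>The space of dimension \<open>D(m)\<close> is the set of real functions on the words of length \<open>m\<close>, extended by
  \<open>undefined\<close> to all words so that points are equal iff their coordinates are. For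
  \<open>|u| = m - 1\<close> the product \<open>ux\<close> in the free group has length \<open>m\<close> iff the concatenation is
  reduced, in which case the two agree (and likewise for \<open>yu\<close>).\<close>

definition Q_poly :: "nat \<Rightarrow> nat \<Rightarrow> (fword \<Rightarrow> real) set" where
  "Q_poly k m = {q \<in> free_words_of_length k m \<rightarrow>\<^sub>E UNIV.
     (\<Sum>v \<in> free_words_of_length k m. q v) = 1 \<and>
     (\<forall>v \<in> free_words_of_length k m. 0 \<le> q v) \<and>
     (\<forall>u \<in> free_words_of_length k (m - 1).
        (\<Sum>x \<in> {x \<in> letters k. u @ [x] \<in> free_words_of_length k m}. q (u @ [x])) =
        (\<Sum>y \<in> {y \<in> letters k. y # u \<in> free_words_of_length k m}. q (y # u)))}"

definition alpha :: "nat \<Rightarrow> nat \<Rightarrow> fword set \<Rightarrow> (fword \<Rightarrow> real)" where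
  "alpha k m W = (\<lambda>v \<in> free_words_of_length k m. cyc_freq W v)"


section \<open>Initial graphs\<close>

record ('a, 'b) labelled_digraph = "('a, 'b) pre_digraph" +
  label :: "'b \<Rightarrow> real"

definition initial_graph ::
    "nat \<Rightarrow> nat \<Rightarrow> (fword \<Rightarrow> real) \<Rightarrow> (fword, fword) labelled_digraph" where
  "initial_graph k m q =
     \<lparr> verts = free_words_of_length k (m - 1), arcs = free_words_of_length k m,
       tail = butlast, head = tl, label = q \<rparr>"

definition remove_zero_arcs ::
    "('a, 'b) labelled_digraph \<Rightarrow> ('a, 'b) labelled_digraph" where
  "remove_zero_arcs G = G \<lparr> arcs := {e \<in> arcs G. label G e \<noteq> 0} \<rparr>"

text \<open>A vertex is isolated if it is incident to no arc; a vertex carrying a loop is not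
  isolated.\<close>

definition remove_isolated_verts ::
    "('a, 'b) labelled_digraph \<Rightarrow> ('a, 'b) labelled_digraph" where
  "remove_isolated_verts G =
     G \<lparr> verts := {v \<in> verts G. \<exists>e \<in> arcs G. tail G e = v \<or> head G e = v} \<rparr>"

definition improved_initial_graph ::
    "nat \<Rightarrow> nat \<Rightarrow> (fword \<Rightarrow> real) \<Rightarrow> (fword, fword) labelled_digraph" where
  "improved_initial_graph k m q = remove_isolated_verts (remove_zero_arcs (initial_graph k m q))"

text \<open>Connectedness of the underlying undirected graph; \<open>truncate\<close> forgets the labels.\<close>

definition undirected_connected :: "('a, 'b) labelled_digraph \<Rightarrow> bool" where
  "undirected_connected G \<longleftrightarrow> Digraph_Component.connected (pre_digraph.truncate G)"

end

theory Submission
  imports Defs "Graph_Theory.Euler"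
begin

text \<open>The windows of length \<open>m\<close> of a cyclic word \<open>w\<close> are the successive arcs of a closed walk
  in the initial graph that uses the arc \<open>v\<close> exactly \<open>n\<^sub>w(v)\<close> times; as it covers all arcs with
  nonzero label, the improved graph is connected. Conversely, let \<open>d\<close> be a common denominator of
  \<open>q\<close> and replace each arc \<open>v\<close> by \<open>d q\<^sub>v\<close> parallel copies. The result is balanced by
  condition (3), so if it is connected then it has a closed Euler trail, and the first letters of
  the arcs of this trail spell a cyclic word of length \<open>d\<close> that has frequencies \<open>q\<close>.\<close>

section \<open>Windows of cyclic words\<close>

text \<open>The start \<open>i\<close> may be any natural number, so the windows form an infinite
  periodic sequence, and \<open>m\<close> may exceed the length of \<open>w\<close>.\<close>

definition cyc_window :: "fword \<Rightarrow> nat \<Rightarrow> nat \<Rightarrow> fword" where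
  "cyc_window w m i = map (\<lambda>j. w ! ((i + j) mod length w)) [0..<m]"

lemma length_cyc_window [simp]: "length (cyc_window w m i) = m"
  by (simp add: cyc_window_def)

lemma nth_cyc_window [simp]: "j < m \<Longrightarrow> cyc_window w m i ! j = w ! ((i + j) mod length w)"
  by (simp add: cyc_window_def)

lemma cyc_window_mod: "cyc_window w m (i mod length w) = cyc_window w m i"
  by (rule nth_equalityI) (simp_all add: mod_add_left_eq)

lemma word_occ_conv_cyc_window:
  "word_occ w u = card {i. i < length w \<and> cyc_window w (length u) i = u}"
  by (simp add: word_occ_def list_eq_iff_nth_eq)

text \<open>Successive windows overlap in all but one letter. In the initial graph this means that
  the arc of one window ends where the arc of the next begins.\<close>

lemma tl_cyc_window: "tl (cyc_window w m i) = butlast (cyc_window w m (Suc i))"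
  by (rule nth_equalityI) (simp_all add: nth_tl nth_butlast)

lemma word_occ_pos_iff:
  assumes "w \<noteq> []"
  shows "word_occ w u \<noteq> 0 \<longleftrightarrow> (\<exists>i. cyc_window w (length u) i = u)"
proof -
  have "word_occ w u \<noteq> 0 \<longleftrightarrow> (\<exists>i < length w. cyc_window w (length u) i = u)"
    by (auto simp: word_occ_conv_cyc_window)
  also have "\<dots> \<longleftrightarrow> (\<exists>i. cyc_window w (length u) i = u)"
    using assms by (metis cyc_window_mod length_greater_0_conv mod_less_divisor)
  finally show ?thesis .
qed

text \<open>Modulo the length, last and first letter are one more adjacent pair, so both parts of
  cyclic reducedness become a single local condition.\<close>

lemma cyclically_reduced_iff:
  assumes "w \<noteq> []"
  shows "cyclically_reduced w \<longleftrightarrow>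
    (\<forall>i < length w. w ! (Suc i mod length w) \<noteq> inv_letter (w ! i))" (is "?L \<longleftrightarrow> ?R")
proof -
  obtain n where n: "length w = Suc n" using assms by (cases w) auto
  have "?L \<longleftrightarrow> (\<forall>i < n. w ! Suc i \<noteq> inv_letter (w ! i)) \<and> w ! 0 \<noteq> inv_letter (w ! n)"
    using assms n by (auto simp: cyclically_reduced_def reduced_def successively_conv_nth
        hd_conv_nth last_conv_nth)
  also have "\<dots> \<longleftrightarrow> ?R"
    using n by (auto simp: All_less_Suc)
  finally show ?thesis .
qed

text \<open>Adjacent letters of a window are cyclically adjacent in \<open>w\<close>, even if the
  window wraps around \<open>w\<close> several times.\<close>

lemma cyc_window_in_free_words:
  assumes "w \<in> cyc_reduced_words k" "w \<noteq> []"
  shows "cyc_window w m i \<in> free_words_of_length k m"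
proof -
  have N: "length w > 0" using assms by simp
  have adj: "w ! (Suc a mod length w) \<noteq> inv_letter (w ! (a mod length w))" for a
    using assms N cyclically_reduced_iff[OF assms(2)] unfolding cyc_reduced_words_def
    by (metis (no_types, lifting) mem_Collect_eq mod_Suc_eq mod_less_divisor)
  have "set (cyc_window w m i) \<subseteq> set w"
    using N by (auto simp: cyc_window_def)
  then show ?thesis
    using assms adj by (auto simp: free_words_of_length_def free_words_def cyc_reduced_words_def
        reduced_def successively_conv_nth)
qed

text \<open>Replaces classes by representatives, on which occurrences and length are computed
  directly. As \<open>q\<close> is extensional, equality with a value of \<open>alpha\<close> can be
  tested on words of length \<open>m\<close>.\<close>

lemma alpha_image_iff:
  assumes "q \<in> free_words_of_length k m \<rightarrow>\<^sub>E UNIV"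
  shows "q \<in> alpha k m ` cyclic_words k \<longleftrightarrow>
    (\<exists>w \<in> cyc_reduced_words k. w \<noteq> [] \<and>
      (\<forall>v \<in> free_words_of_length k m. q v = real (word_occ w v) / real (length w)))"
    (is "_ \<longleftrightarrow> ?R")
proof -
  have cw: "cyclic_words k = {cyc_rel k `` {w} | w. w \<in> cyc_reduced_words k \<and> w \<noteq> []}"
  proof -
    have "cyc_rel k `` {w} = {[]} \<longleftrightarrow> w = []" if "w \<in> cyc_reduced_words k" for w
    proof
      assume "cyc_rel k `` {w} = {[]}"
      then show "w = []" using equiv_class_self[OF equiv_cyc_rel that] by auto
    next
      assume "w = []"
      then show "cyc_rel k `` {w} = {[]}" using that by (auto simp: cyc_rel_def)
    qed
    then show ?thesis unfolding cyclic_words_def quotient_def by auto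
  qed
  have al: "q = alpha k m (cyc_rel k `` {w}) \<longleftrightarrow>
      (\<forall>v \<in> free_words_of_length k m. q v = real (word_occ w v) / real (length w))"
    if "w \<in> cyc_reduced_words k" for w
    using assms that
    by (auto simp: alpha_def cyc_freq_def cyc_occ_class cyc_length_class PiE_def fun_eq_iff
        extensional_def restrict_def)
  show ?thesis unfolding cw using al by blast
qed

section \<open>Initial graphs\<close>

lemma finite_free_words_of_length: "finite (free_words_of_length k m)"
  by (rule finite_subset[OF _ finite_lists_length_eq[of "letters k" m]])
    (auto simp: free_words_of_length_def free_words_def letters_def)

lemma butlast_in_free_words:
  "v \<in> free_words_of_length k m \<Longrightarrow> butlast v \<in> free_words_of_length k (m - 1)"
  by (auto simp: free_words_of_length_def free_words_def reduced_def successively_conv_nth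
      nth_butlast dest: in_set_butlastD)

lemma tl_in_free_words:
  "v \<in> free_words_of_length k m \<Longrightarrow> tl v \<in> free_words_of_length k (m - 1)"
  by (cases v) (auto simp: free_words_of_length_def free_words_def reduced_def
      successively_conv_nth)

text \<open>The ends of an arc are always vertices of the initial graph, so what survives the
  removal of isolated vertices is exactly the set of ends of the arcs in \<open>A\<close>.\<close>

lemma truncate_improved_initial_graph:
  fixes k m :: nat and q :: "fword \<Rightarrow> real"
  defines "A \<equiv> {v \<in> free_words_of_length k m. q v \<noteq> 0}"
  shows "pre_digraph.truncate (improved_initial_graph k m q) =
    \<lparr>verts = butlast ` A \<union> tl ` A, arcs = A, tail = butlast, head = tl\<rparr>"
  by (auto simp: A_def improved_initial_graph_def remove_isolated_verts_def
      remove_zero_arcs_def initial_graph_def pre_digraph.truncate_def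
      simp del: One_nat_def intro: butlast_in_free_words tl_in_free_words)

lemma undirected_connected_if_cyclic_word:
  assumes w: "w \<in> cyc_reduced_words k" "w \<noteq> []"
    and q: "\<forall>v \<in> free_words_of_length k m. q v = real (word_occ w v) / real (length w)"
  shows "undirected_connected (improved_initial_graph k m q)"
proof -
  define A where "A = {v \<in> free_words_of_length k m. q v \<noteq> 0}"
  define G where "G = \<lparr>verts = butlast ` A \<union> tl ` A, arcs = A, tail = butlast, head = tl\<rparr>"
  \<comment> \<open>The arcs that survive are the windows of \<open>w\<close>, so a single walk
    starting at \<open>T 0\<close> meets every vertex.\<close>
  have "q v \<noteq> 0 \<longleftrightarrow> (\<exists>i. v = cyc_window w m i)" if "v \<in> free_words_of_length k m" for v
  proof -
    have "length v = m" using that by (simp add: free_words_of_length_def)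
    moreover have "q v \<noteq> 0 \<longleftrightarrow> word_occ w v \<noteq> 0" using that q w by simp
    ultimately show ?thesis using word_occ_pos_iff[OF w(2), of v] by metis
  qed
  then have A: "A = range (cyc_window w m)"
    using cyc_window_in_free_words[OF w] by (auto simp: A_def)
  interpret wf_digraph G by unfold_locales (auto simp: G_def)
  define T where "T i = butlast (cyc_window w m i)" for i
  have verts: "verts G = range T"
    by (auto simp: G_def A T_def tl_cyc_window)
  have step: "T i \<rightarrow>\<^bsub>G\<^esub> T (Suc i)" for i
    unfolding arcs_ends_def arc_to_ends_def
    by (rule image_eqI[of _ _ "cyc_window w m i"]) (auto simp: G_def A T_def tl_cyc_window)
  have reach: "T 0 \<rightarrow>\<^sup>*\<^bsub>G\<^esub> T i" for i
  proof (induction i)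
    case 0
    show ?case using verts by auto
  next
    case (Suc i)
    then show ?case using step[of i] by (rule reachable_adj_trans)
  qed
  interpret S: pair_wf_digraph "mk_symmetric G" ..
  have "connected G"
  proof (rule connectedI)
    show "verts G \<noteq> {}" using verts by auto
  next
    fix u v assume "u \<in> verts G" "v \<in> verts G"
    then obtain i j where "u = T i" "v = T j" using verts by auto
    then have u: "T 0 \<rightarrow>\<^sup>*\<^bsub>mk_symmetric G\<^esub> u" and v: "T 0 \<rightarrow>\<^sup>*\<^bsub>mk_symmetric G\<^esub> v"
      using reach by (auto intro: reachable_mk_symmetricI)
    \<comment> \<open>In the symmetric closure the walk from \<open>T 0\<close> to \<open>u\<close>
      can be reversed and then continued to \<open>v\<close>.\<close>
    show "u \<rightarrow>\<^sup>*\<^bsub>mk_symmetric G\<^esub> v"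
      by (rule S.reachable_trans[OF symmetric_reachable[OF symmetric_mk_symmetric u] v])
  qed
  then show ?thesis
    unfolding undirected_connected_def truncate_improved_initial_graph G_def A_def .
qed

section \<open>Closed Euler trails of the multigraph\<close>

text \<open>Induction on \<open>S\<close>, multiplying the denominators. Nonnegativity makes the
  scaled values naturals, so that they can count copies of arcs.\<close>

lemma common_denominator:
  fixes q :: "'a \<Rightarrow> real"
  assumes "finite S" "\<forall>v \<in> S. q v \<in> \<rat> \<and> 0 \<le> q v"
  obtains d :: nat and n :: "'a \<Rightarrow> nat"
  where "d > 0" "\<forall>v \<in> S. real (n v) = real d * q v"
proof -
  have "\<exists>d::nat. d > 0 \<and> (\<forall>v \<in> S. real d * q v \<in> \<nat>)"
    using assms
  proof (induction S)
    case empty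
    then show ?case by auto
  next
    case (insert x S)
    then obtain d :: nat where d: "d > 0" "\<forall>v \<in> S. real d * q v \<in> \<nat>" by auto
    obtain a b :: nat where ab: "b \<noteq> 0" "\<bar>q x\<bar> = real a / real b"
      using insert.prems Rats_abs_nat_div_natE by (metis insertI1)
    then have qx: "real b * q x = real a" using insert.prems by auto
    have "real (d * b) * q v \<in> \<nat>" if "v \<in> insert x S" for v
    proof (cases "v = x")
      case True
      have "real (d * b) * q x = real (d * a)" using qx by simp
      then show ?thesis using True by (metis of_nat_in_Nats)
    next
      case False
      then have "real b * (real d * q v) \<in> \<nat>" using that d(2) by (metis Nats_mult insertE of_nat_in_Nats)
      moreover have "real (d * b) * q v = real b * (real d * q v)" by simp
      ultimately show ?thesis by metis
    qed
    then show ?case using d ab by (intro exI[of _ "d * b"]) auto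
  qed
  then obtain d :: nat where "d > 0" "\<forall>v \<in> S. \<exists>n. real n = real d * q v"
    by (metis Nats_cases)
  then show ?thesis using that by metis
qed

lemma closed_walk_nth:
  assumes "pre_digraph.cas G u p u" "i < length p"
  shows "tail G (p ! (Suc i mod length p)) = head G (p ! i)"
proof -
  \<comment> \<open>Stated for open walks, since the recursion of \<open>cas\<close> moves the start
    vertex. Closedness enters only at the wrap-around from the last arc to the first.\<close>
  have gen: "(p \<noteq> [] \<longrightarrow> tail G (p ! 0) = u \<and> head G (p ! (length p - 1)) = v) \<and>
      (\<forall>i. Suc i < length p \<longrightarrow> tail G (p ! Suc i) = head G (p ! i))"
    if "pre_digraph.cas G u p v" for u v p
    using that
  proof (induction p arbitrary: u)
    case Nil
    then show ?case by simp
  next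
    case (Cons e p)
    then have "tail G e = u" "pre_digraph.cas G (head G e) p v"
      by (auto simp: pre_digraph.cas.simps)
    with Cons.IH[of "head G e"] show ?case
      by (cases p) (auto simp: nth_Cons pre_digraph.cas.simps split: nat.splits)
  qed
  show ?thesis
  proof (cases "Suc i = length p")
    case True
    then show ?thesis using gen[OF assms(1)] assms(2) by (metis diff_Suc_1 length_greater_0_conv
          less_nat_zero_code list.size(3) mod_self)
  next
    case False
    then show ?thesis using gen[OF assms(1)] assms(2) by simp
  qed
qed

text \<open>Condition (3) in terms of arcs: those leaving \<open>u\<close> are the words
  \<open>u @ [x]\<close>, those entering it the words \<open>y # u\<close>.\<close>

lemma Q_poly_balance:
  assumes q: "q \<in> Q_poly k m" and m: "m \<ge> 1" and u: "u \<in> free_words_of_length k (m - 1)"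
  shows "(\<Sum>v \<in> {v \<in> free_words_of_length k m. butlast v = u}. q v) =
    (\<Sum>v \<in> {v \<in> free_words_of_length k m. tl v = u}. q v)"
proof -
  have ne: "v \<noteq> []" "last v \<in> letters k" "hd v \<in> letters k"
    if "v \<in> free_words_of_length k m" for v
  proof -
    show "v \<noteq> []" using that m by (auto simp: free_words_of_length_def)
    then show "last v \<in> letters k" "hd v \<in> letters k"
      using that last_in_set[of v] hd_in_set[of v]
      by (auto simp: free_words_of_length_def free_words_def)
  qed
  have "(\<Sum>v \<in> {v \<in> free_words_of_length k m. butlast v = u}. q v) =
      (\<Sum>x \<in> {x \<in> letters k. u @ [x] \<in> free_words_of_length k m}. q (u @ [x]))"
    using ne by (intro sum.reindex_bij_witness[of _ "\<lambda>x. u @ [x]" last])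
      (auto simp: append_butlast_last_id)
  also have "\<dots> = (\<Sum>y \<in> {y \<in> letters k. y # u \<in> free_words_of_length k m}. q (y # u))"
    using q u by (simp add: Q_poly_def)
  also have "\<dots> = (\<Sum>v \<in> {v \<in> free_words_of_length k m. tl v = u}. q v)"
    using ne by (intro sum.reindex_bij_witness[of _ hd "\<lambda>y. y # u"]) auto
  finally show ?thesis .
qed

lemma cyclic_word_of_closed_walk:
  fixes vs :: "fword list"
  assumes m: "m \<ge> 2" and vs: "vs \<noteq> []" "set vs \<subseteq> free_words_of_length k m"
    and walk: "\<And>i. i < length vs \<Longrightarrow> butlast (vs ! (Suc i mod length vs)) = tl (vs ! i)"
  defines "w \<equiv> map hd vs"
  shows "w \<in> cyc_reduced_words k"
    and "i < length vs \<Longrightarrow> cyc_window w m i = vs ! i"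
proof -
  define N where "N = length vs"
  have N: "N > 0" "length w = N" using vs by (auto simp: N_def w_def)
  have fw: "vs ! (i mod N) \<in> free_words_of_length k m" for i
    using vs N by (auto simp: N_def)
  then have len: "length (vs ! (i mod N)) = m" for i
    by (auto simp: free_words_of_length_def)
  \<comment> \<open>Letter \<open>j\<close> of an arc is the first letter of the arc
    \<open>j\<close> steps later: each step of the walk moves a letter one place to the
    left.\<close>
  have shift: "vs ! (i mod N) ! j = vs ! ((i + j) mod N) ! 0" if "j < m" for i j
    using that
  proof (induction j arbitrary: i)
    case 0
    then show ?case by simp
  next
    case (Suc j)
    have "vs ! (i mod N) ! Suc j = tl (vs ! (i mod N)) ! j"
      using Suc.prems len[of i] by (simp add: nth_tl)
    also have "\<dots> = butlast (vs ! (Suc i mod N)) ! j"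
      using walk[of "i mod N"] N by (simp add: N_def mod_Suc_eq)
    also have "\<dots> = vs ! (Suc i mod N) ! j"
      using Suc.prems len[of "Suc i"] by (simp add: nth_butlast)
    also have "\<dots> = vs ! ((i + Suc j) mod N) ! 0"
      using Suc by simp
    finally show ?case .
  qed
  have nth_w: "w ! (i mod N) = vs ! (i mod N) ! 0" for i
    using N len[of i] m by (simp add: w_def N_def hd_conv_nth) (metis hd_conv_nth list.size(3) not_numeral_le_zero)
  have win: "cyc_window w m i = vs ! (i mod N)" for i
    by (rule nth_equalityI) (simp_all add: len N(2) nth_w shift[symmetric])
  show "cyc_window w m i = vs ! i" if "i < length vs"
    using win[of i] that by (simp add: N_def)
  \<comment> \<open>As \<open>m\<close> is at least 2, each window shows a cyclically adjacent pair,
    so reduced windows make \<open>w\<close> cyclically reduced, also when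
    \<open>N = 1\<close>.\<close>
  have two: "w ! (Suc i mod N) \<noteq> inv_letter (w ! i)" if "i < N" for i
  proof -
    have two_le: "Suc 0 < m" using m by simp
    have "reduced (cyc_window w m i)" using fw[of i] win[of i]
      by (simp add: free_words_of_length_def free_words_def)
    then have "cyc_window w m i ! Suc 0 \<noteq> inv_letter (cyc_window w m i ! 0)"
      using two_le unfolding reduced_def successively_conv_nth length_cyc_window by blast
    then show ?thesis using m that N by simp
  qed
  have "w \<noteq> []" using N by auto
  then have "cyclically_reduced w" using cyclically_reduced_iff two N by auto
  moreover have "set w \<subseteq> letters k"
  proof
    fix x assume "x \<in> set w"
    then obtain v where v: "v \<in> set vs" "x = hd v" by (auto simp: w_def)
    then have "set v \<subseteq> letters k" "v \<noteq> []" using vs m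
      by (auto simp: free_words_of_length_def free_words_def)
    then show "x \<in> letters k" using v hd_in_set by blast
  qed
  ultimately show "w \<in> cyc_reduced_words k"
    by (auto simp: cyc_reduced_words_def free_words_def cyclically_reduced_def)
qed

lemma cyclic_word_if_undirected_connected:
  assumes m: "m \<ge> 2" and q: "q \<in> Q_poly k m"
    and rat: "\<forall>v \<in> free_words_of_length k m. q v \<in> \<rat>"
    and con: "undirected_connected (improved_initial_graph k m q)"
  shows "\<exists>w \<in> cyc_reduced_words k. w \<noteq> [] \<and>
    (\<forall>v \<in> free_words_of_length k m. q v = real (word_occ w v) / real (length w))"
proof -
  let ?F = "free_words_of_length k m"
  have "\<forall>v \<in> ?F. q v \<in> \<rat> \<and> 0 \<le> q v" using rat q by (auto simp: Q_poly_def)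
  then obtain d n where d: "d > 0" and n: "\<forall>v \<in> ?F. real (n v) = real d * q v"
    using common_denominator[OF finite_free_words_of_length] by blast
  define A where "A = {v \<in> ?F. q v \<noteq> 0}"
  \<comment> \<open>The pairs \<open>(v, j)\<close> are the parallel copies of \<open>v\<close>; an
    arc with label 0 gets none.\<close>
  define B where "B = (SIGMA v:?F. {..<n v})"
  define G where "G = \<lparr>verts = butlast ` A \<union> tl ` A, arcs = A, tail = butlast, head = tl\<rparr>"
  define H where "H = \<lparr>verts = butlast ` A \<union> tl ` A, arcs = B,
      tail = butlast \<circ> fst, head = tl \<circ> fst\<rparr>"
  have finB: "finite B" by (simp add: B_def finite_free_words_of_length)
  have "q v \<noteq> 0 \<longleftrightarrow> n v > 0" if "v \<in> ?F" for v
  proof -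
    have "n v > 0 \<longleftrightarrow> real (n v) \<noteq> 0" by simp
    also have "\<dots> \<longleftrightarrow> q v \<noteq> 0" using n d that by simp
    finally show ?thesis by simp
  qed
  then have "v \<in> A \<longleftrightarrow> v \<in> ?F \<and> n v > 0" for v by (auto simp: A_def)
  then have A: "A = fst ` B" by (force simp: B_def)
  interpret H: fin_digraph H
    by unfold_locales (use finB in \<open>auto simp: H_def A\<close>)
  have "connected G"
    using con unfolding undirected_connected_def truncate_improved_initial_graph G_def A_def .
  \<comment> \<open>\<open>mk_symmetric\<close> records only pairs of end vertices, and every arc in
    \<open>A\<close> has at least one copy, so multiplicities do not affect connectedness.\<close>
  moreover have "mk_symmetric G = mk_symmetric H"
    by (simp add: mk_symmetric_def G_def H_def A)
  ultimately have "connected H" by (simp add: connected_def)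
  moreover have "in_degree H u = out_degree H u" if "u \<in> verts H" for u
  proof -
    have u: "u \<in> free_words_of_length k (m - 1)"
      using that by (auto simp: H_def A_def simp del: One_nat_def
          intro: butlast_in_free_words tl_in_free_words)
    \<comment> \<open>Counting copies scales sums of \<open>q\<close> by \<open>d\<close>; with
      \<open>P\<close> selecting the arcs into or out of \<open>u\<close>, this turns the balance of
      \<open>q\<close> into equality of degrees.\<close>
    have deg: "real (card {e \<in> B. P (fst e)}) = real d * (\<Sum>v \<in> {v \<in> ?F. P v}. q v)" for P
    proof -
      have "{e \<in> B. P (fst e)} = (SIGMA v:{v \<in> ?F. P v}. {..<n v})" by (auto simp: B_def)
      then have "card {e \<in> B. P (fst e)} = (\<Sum>v \<in> {v \<in> ?F. P v}. n v)"
        by (simp add: finite_free_words_of_length)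
      then show ?thesis using n by (simp add: sum_distrib_left)
    qed
    have "real (in_degree H u) = real (out_degree H u)"
      using deg[of "\<lambda>v. tl v = u"] deg[of "\<lambda>v. butlast v = u"] Q_poly_balance[OF q _ u] m
      by (simp add: in_degree_def out_degree_def in_arcs_def out_arcs_def H_def)
    then show ?thesis by simp
  qed
  ultimately obtain u p where p: "H.euler_trail u p u"
    using H.closed_euler1 by blast
  then have cas: "H.cas u p u" and dist: "distinct p" and "set p = arcs H"
    by (auto simp: H.euler_trail_def H.trail_def H.awalk_def)
  then have setp: "set p = B" by (simp add: H_def)
  \<comment> \<open>The coordinates of \<open>q\<close> sum to 1, so there are \<open>d\<close>
    copies in total. Since \<open>d > 0\<close>, the trail and hence the word are nonempty.\<close>
  have lenp: "length p = d"
  proof -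
    have "card B = (\<Sum>v \<in> ?F. n v)" by (simp add: B_def finite_free_words_of_length)
    then have "real (card B) = real d * (\<Sum>v \<in> ?F. q v)" using n by (simp add: sum_distrib_left)
    also have "\<dots> = real d" using q by (simp add: Q_poly_def)
    finally show ?thesis using dist setp by (metis distinct_card of_nat_eq_iff)
  qed
  define vs where "vs = map fst p"
  define w where "w = map hd vs"
  have vs: "vs \<noteq> []" "set vs \<subseteq> ?F"
  proof -
    show "vs \<noteq> []" using lenp d by (auto simp: vs_def)
    have "set vs = fst ` B" by (simp add: vs_def setp)
    then show "set vs \<subseteq> ?F" by (auto simp: B_def)
  qed
  have walk: "butlast (vs ! (Suc i mod length vs)) = tl (vs ! i)" if "i < length vs" for i
  proof -
    have "Suc i mod length p < length p" using lenp d by simp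
    then show ?thesis using closed_walk_nth[OF cas, of i] that by (simp add: vs_def H_def)
  qed
  note w = cyclic_word_of_closed_walk[OF m vs walk, folded w_def]
  have occ: "word_occ w v = n v" if v: "v \<in> ?F" for v
  proof -
    have "length v = m" using v by (simp add: free_words_of_length_def)
    then have "word_occ w v = card {i. i < length p \<and> fst (p ! i) = v}"
      using w(2) by (auto simp: word_occ_conv_cyc_window vs_def w_def intro!: arg_cong[of _ _ card])
    \<comment> \<open>The Euler trail uses each copy exactly once, so the positions showing
      \<open>v\<close> correspond to the \<open>n v\<close> copies of \<open>v\<close>.\<close>
    also have "\<dots> = card ((!) p ` {i. i < length p \<and> fst (p ! i) = v})"
      using dist by (intro card_image[symmetric]) (auto simp: inj_on_def nth_eq_iff_index_eq)
    also have "(!) p ` {i. i < length p \<and> fst (p ! i) = v} = {e \<in> set p. fst e = v}"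
      unfolding set_conv_nth image_def by auto
    also have "\<dots> = {v} \<times> {..<n v}" using v by (auto simp: setp B_def)
    finally show ?thesis by simp
  qed
  have "q v = real (word_occ w v) / real (length w)" if "v \<in> ?F" for v
    using occ[OF that] n that d lenp by (simp add: w_def vs_def)
  moreover have "w \<noteq> []" using vs by (simp add: w_def)
  ultimately show ?thesis using w(1) by blast
qed

theorem theorem4p5:
  fixes k m :: nat and q :: "fword \<Rightarrow> real"
  assumes "k \<ge> 2"
    and "m \<ge> 2"
    and "q \<in> Q_poly k m"
    and "\<forall>v \<in> free_words_of_length k m. q v \<in> \<rat>"
  shows "q \<in> alpha k m ` cyclic_words k \<longleftrightarrow>
         undirected_connected (improved_initial_graph k m q)"
proof -
  have "q \<in> free_words_of_length k m \<rightarrow>\<^sub>E UNIV" using assms(3) by (simp add: Q_poly_def)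
  note image = alpha_image_iff[OF this]
  show ?thesis
    unfolding image
    using undirected_connected_if_cyclic_word cyclic_word_if_undirected_connected[OF assms(2-4)]
    by blast
qed

end
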